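(* Let $\mathsf{A}\in\mathbb{R}^{J_1\times I_1\times\cdots\times J_N\times I_N}$ be an even-order paired tensor, and let $\tilde{\mathsf{A}}\in\mathbb{R}^{J_1\times\cdots\times J_N\times I_1\times\cdots\times I_N}$ be the tensor with entries $\tilde{\mathsf{A}}_{j_1\cdots j_Ni_1\cdots i_N}=\mathsf{A}_{j_1i_1\cdots j_Ni_N}$. Then $\operatorname{rank}_U(\mathsf{A})=\tilde{R}_N$, where $\tilde{R}_N$ is the $N$-th optimal TT-rank of $\tilde{\mathsf{A}}$.
   Context: Let $ivec(\mathbf{j},\mathcal{J})=j_1+\sum_{k=2}^N (j_k-1)\prod_{l=1}^{k-1}J_l$. The unfolding $\varphi(\mathsf{A})$ of an even-order paired tensor is the $\prod_nJ_n\times\prod_nI_n$ matrix with entry $\mathsf{A}_{j_1i_1\cdots j_Ni_N}$ in row $ivec(\mathbf{j},\mathcal{J})$ and column $ivec(\mathbf{i},\mathcal{I})$, and $\operatorname{rank}_U(\mathsf{A})=\operatorname{rank}(\varphi(\mathsf{A}))$. A tensor train decomposition (TTD) of $\mathsf{X}\in\mathbb{R}^{L_1\times\cdots\times L_M}$ is an expression $\mathsf{X}_{l_1\cdots l_M}=\sum_{r_0=1}^{R_0}\cdots\sum_{r_M=1}^{R_M}\mathsf{X}^{(1)}_{r_0l_1r_1}\cdots\mathsf{X}^{(M)}_{r_{M-1}l_Mr_M}$ with core tensors $\mathsf{X}^{(n)}\in\mathbb{R}^{R_{n-1}\times L_n\times R_n}$ and TT-ranks $R_0,\dots,R_M$,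 $R_0=R_M=1$. The optimal TT-ranks are $R_n=\operatorname{rank}(\texttt{reshape}(\mathsf{X},\prod_{i=1}^nL_i,\prod_{i=n+1}^ML_i))$ for $1\le n\le M-1$, i.e. the rank of the matrix with rows indexed by $(l_1,\dots,l_n)$ and columns indexed by $(l_{n+1},\dots,l_M)$ (first index varying fastest in each case). *)

theory Defs
  imports "Jordan_Normal_Form.DL_Rank" "HOL-Library.FuncSet"
begin

text \<open>Multi-indices are lists with 1-based entries; the size list \<open>L\<close> is \<open>[L\<^sub>1, \<dots>, L\<^sub>M]\<close>.\<close>

definition multi_indices :: "nat list \<Rightarrow> nat list set" where
  "multi_indices L = {l. length l = length L \<and> (\<forall>k<length L. 1 \<le> l ! k \<and> l ! k \<le> L ! k)}"

text \<open>The real tensors of size \<open>L\<^sub>1 \<times> \<cdots> \<times> L\<^sub>M\<close>, as functions on multi-indices.\<close>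

definition tensors :: "nat list \<Rightarrow> (nat list \<Rightarrow> real) set" where
  "tensors L = multi_indices L \<rightarrow>\<^sub>E UNIV"

text \<open>\<open>j\<^sub>1 + (\<Sum>k=2..N. (j\<^sub>k - 1) * (\<Prod>l=1..k-1. J\<^sub>l))\<close>, with list positions shifted by one.
  The subtraction is only used for entries \<open>\<ge> 1\<close>.\<close>

definition ivec :: "nat list \<Rightarrow> nat list \<Rightarrow> nat" where
  "ivec j J = j ! 0 + (\<Sum>k=1..<length J. (j ! k - 1) * (\<Prod>l<k. J ! l))"

text \<open>On \<open>multi_indices J\<close>, the map \<open>ivec\<close> is a bijection onto \<open>{1..\<Prod>\<^sub>n J\<^sub>n}\<close> (for nonempty \<open>J\<close>);
  this is its inverse.\<close>

definition multi_index_at :: "nat list \<Rightarrow> nat \<Rightarrow> nat list" where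
  "multi_index_at J p = (THE j. j \<in> multi_indices J \<and> ivec j J = p)"

text \<open>An even-order paired tensor of size \<open>J\<^sub>1 \<times> I\<^sub>1 \<times> \<cdots> \<times> J\<^sub>N \<times> I\<^sub>N\<close> is an element of
  \<open>tensors (splice J I)\<close>, and its entry at \<open>j\<^sub>1 i\<^sub>1 \<dots> j\<^sub>N i\<^sub>N\<close> is \<open>A (splice j i)\<close>.
  Rows and columns of matrices are numbered from 0, hence the \<open>+ 1\<close>.\<close>

definition unfolding_mat :: "nat list \<Rightarrow> nat list \<Rightarrow> (nat list \<Rightarrow> real) \<Rightarrow> real mat" where
  "unfolding_mat J I A = mat (\<Prod>n<length J. J ! n) (\<Prod>n<length I. I ! n)
     (\<lambda>(r, c). A (splice (multi_index_at J (r + 1)) (multi_index_at I (c + 1))))"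

abbreviation mat_rank :: "real mat \<Rightarrow> nat" where
  "mat_rank M \<equiv> vec_space.rank (dim_row M) M"

definition rank_U :: "nat list \<Rightarrow> nat list \<Rightarrow> (nat list \<Rightarrow> real) \<Rightarrow> nat" where
  "rank_U J I A = mat_rank (unfolding_mat J I A)"

text \<open>The usual column-major reshape of a tensor into a \<open>p \<times> q\<close> matrix: the entries of \<open>X\<close>, listed
  with the first index varying fastest, fill the matrix column by column.\<close>

definition reshape :: "nat list \<Rightarrow> (nat list \<Rightarrow> real) \<Rightarrow> nat \<Rightarrow> nat \<Rightarrow> real mat" where
  "reshape L X p q = mat p q (\<lambda>(r, c). X (multi_index_at L (r + c * p + 1)))"

text \<open>Meaningful for \<open>1 \<le> n \<le> length L - 1\<close>.\<close>

definition optimal_TT_rank :: "nat list \<Rightarrow> (nat list \<Rightarrow> real) \<Rightarrow> nat \<Rightarrow> nat" where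
  "optimal_TT_rank L X n =
     mat_rank (reshape L X (\<Prod>i<n. L ! i) (\<Prod>i=n..<length L. L ! i))"

end

theory Submission
  imports Defs
begin

text \<open>The index \<open>ivec l L - 1\<close> is the number with mixed-radix digits \<open>l\<^sub>k - 1\<close> in the bases \<open>L\<^sub>k\<close>, and
  concatenating digit lists \<open>j\<close>, \<open>i\<close> gives the number \<open>r + (\<Prod>\<^sub>n J\<^sub>n) * c\<close>. By uniqueness of
  mixed-radix digits, the unfolding of \<open>A\<close> and the \<open>N\<close>-th reshape of \<open>A_tilde\<close> are therefore the same
  matrix.\<close>

text \<open>Horner form of the sum in \<open>ivec\<close>, with digits counted from 0. Inductions on
  the size list can then split off the fastest digit by \<open>mod n\<close> and the remaining
  digits by \<open>div n\<close>.\<close>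

fun mixed_radix :: "nat list \<Rightarrow> nat list \<Rightarrow> nat" where
  "mixed_radix (x # l) (n # L) = (x - 1) + n * mixed_radix l L"
| "mixed_radix _ _ = 0"

lemma multi_indices_Nil [simp]: "multi_indices [] = {[]}"
  by (auto simp: multi_indices_def)

lemma Cons_in_multi_indices [simp]:
  "x # l \<in> multi_indices (n # L) \<longleftrightarrow> 1 \<le> x \<and> x \<le> n \<and> l \<in> multi_indices L"
  by (auto simp: multi_indices_def less_Suc_eq_0_disj)

lemma length_multi_indices: "l \<in> multi_indices L \<Longrightarrow> length l = length L"
  by (simp add: multi_indices_def)

lemma multi_indices_ConsE:
  assumes "l \<in> multi_indices (n # L)"
  obtains x l' where "l = x # l'" "1 \<le> x" "x \<le> n" "l' \<in> multi_indices L"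
  using assms length_multi_indices[OF assms] by (cases l) auto

lemma append_in_multi_indices:
  assumes "j \<in> multi_indices J" "i \<in> multi_indices I"
  shows "j @ i \<in> multi_indices (J @ I)"
  using assms(1)
proof (induction J arbitrary: j)
  case Nil
  then show ?case using assms(2) by simp
next
  case (Cons n J)
  then show ?case by (auto elim!: multi_indices_ConsE)
qed

lemma mixed_radix_append:
  "length j = length J \<Longrightarrow>
    mixed_radix (j @ i) (J @ I) = mixed_radix j J + prod_list J * mixed_radix i I"
  by (induction j J rule: list_induct2) (auto simp: algebra_simps)

lemma mixed_radix_inj:
  assumes "l \<in> multi_indices L" "l' \<in> multi_indices L" "mixed_radix l L = mixed_radix l' L"
  shows "l = l'"
  using assms
proof (induction L arbitrary: l l')
  case Nil
  then show ?case by simp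
next
  case (Cons n L)
  obtain x k where x: "l = x # k" "1 \<le> x" "x \<le> n" "k \<in> multi_indices L"
    using Cons.prems(1) by (rule multi_indices_ConsE)
  obtain y m where y: "l' = y # m" "1 \<le> y" "y \<le> n" "m \<in> multi_indices L"
    using Cons.prems(2) by (rule multi_indices_ConsE)
  have eq: "(x - 1) + n * mixed_radix k L = (y - 1) + n * mixed_radix m L"
    using Cons.prems(3) x y by simp
  have less: "x - 1 < n" "y - 1 < n"
    using x y by auto
  \<comment> \<open>Both lowest digits are below \<open>n\<close>, so remainder and quotient modulo
    \<open>n\<close> separate them from the higher digits.\<close>
  have "x - 1 = y - 1"
    using arg_cong[OF eq, of "\<lambda>v. v mod n"] less by simp
  moreover have "mixed_radix k L = mixed_radix m L"
    using arg_cong[OF eq, of "\<lambda>v. v div n"] less by simp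
  ultimately show ?case
    using Cons.IH[OF x(4) y(4)] x y by simp
qed

lemma mixed_radix_surj:
  "p < prod_list L \<Longrightarrow> \<exists>l\<in>multi_indices L. mixed_radix l L = p"
proof (induction L arbitrary: p)
  case Nil
  then show ?case by simp
next
  case (Cons n L)
  \<comment> \<open>A zero size would make the product 0, leaving no room for
    \<open>p\<close>.\<close>
  then have n: "n > 0"
    by (auto intro!: Nat.gr0I)
  have "p div n < prod_list L"
    using Cons.prems by (simp add: less_mult_imp_div_less mult.commute)
  then obtain l where l: "l \<in> multi_indices L" "mixed_radix l L = p div n"
    using Cons.IH by blast
  have "(p mod n + 1) # l \<in> multi_indices (n # L)"
    using l n by (simp add: Suc_leI)
  moreover have "mixed_radix ((p mod n + 1) # l) (n # L) = p"
    using l by simp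
  ultimately show ?case by blast
qed

text \<open>Shifting the summation index by one pulls the factor \<open>n\<close> out of all later
  partial products, which is one step of the Horner recursion.\<close>

lemma mixed_radix_conv_sum:
  "length l = length L \<Longrightarrow>
    mixed_radix l L = (\<Sum>k<length L. (l ! k - 1) * (\<Prod>m<k. L ! m))"
proof (induction l L rule: list_induct2)
  case Nil
  then show ?case by simp
next
  case (Cons x l n L)
  then show ?case
    by (simp add: sum.lessThan_Suc_shift prod.lessThan_Suc_shift sum_distrib_left mult.left_commute
        del: sum.lessThan_Suc prod.lessThan_Suc)
qed

lemma ivec_eq_mixed_radix:
  assumes "l \<in> multi_indices L" "L \<noteq> []"
  shows "ivec l L = mixed_radix l L + 1"
proof -
  \<comment> \<open>\<open>ivec\<close> adds the first entry without subtracting 1. Since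
    subtraction on naturals is truncated, this bound is what makes that entry equal to its digit
    plus 1.\<close>
  have "l ! 0 \<ge> 1"
    using assms by (simp add: multi_indices_def)
  moreover have "{..<length L} = insert 0 {1..<length L}"
    using assms(2) by (auto simp: Suc_le_eq)
  ultimately show ?thesis
    using length_multi_indices[OF assms(1)]
    by (simp add: ivec_def mixed_radix_conv_sum)
qed

text \<open>Evaluates the definite description from a witness: a multi-index with digit value
  \<open>p\<close> is the only one, by injectivity.\<close>

lemma multi_index_at_eq:
  assumes "l \<in> multi_indices L" "L \<noteq> []" "mixed_radix l L = p"
  shows "multi_index_at L (p + 1) = l"
  unfolding multi_index_at_def
proof (rule the_equality)
  show "l \<in> multi_indices L \<and> ivec l L = p + 1"
    using assms by (simp add: ivec_eq_mixed_radix)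
next
  fix k assume "k \<in> multi_indices L \<and> ivec k L = p + 1"
  then show "k = l"
    using assms by (auto intro: mixed_radix_inj simp: ivec_eq_mixed_radix)
qed

lemma prod_nth_eq_prod_list: "(\<Prod>k<length L. L ! k) = prod_list L"
  by (simp add: prod.list_conv_set_nth atLeast0LessThan)

lemma unfolding_mat_eq_reshape:
  assumes "J \<noteq> []" "I \<noteq> []"
    and eq: "\<And>j i. j \<in> multi_indices J \<Longrightarrow> i \<in> multi_indices I \<Longrightarrow> B (j @ i) = A (splice j i)"
  shows "unfolding_mat J I A = reshape (J @ I) B (prod_list J) (prod_list I)"
proof (rule eq_matI)
  fix r c
  assume "r < dim_row (reshape (J @ I) B (prod_list J) (prod_list I))"
    and "c < dim_col (reshape (J @ I) B (prod_list J) (prod_list I))"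
  then have r: "r < prod_list J" and c: "c < prod_list I"
    by (simp_all add: reshape_def)
  obtain j where j: "j \<in> multi_indices J" "mixed_radix j J = r"
    using mixed_radix_surj[OF r] by blast
  obtain i where i: "i \<in> multi_indices I" "mixed_radix i I = c"
    using mixed_radix_surj[OF c] by blast
  \<comment> \<open>In \<open>j @ i\<close> the digits of \<open>i\<close> come after those of
    \<open>j\<close>, so their weights gain the factor \<open>prod_list J\<close>. This is the
    column-major position of row \<open>r\<close> in column \<open>c\<close>.\<close>
  have "mixed_radix (j @ i) (J @ I) = r + c * prod_list J"
    using j i by (simp add: mixed_radix_append length_multi_indices)
  then have "multi_index_at (J @ I) (r + c * prod_list J + 1) = j @ i"
    using assms(1) j i by (intro multi_index_at_eq append_in_multi_indices) auto
  moreover have "multi_index_at J (r + 1) = j" "multi_index_at I (c + 1) = i"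
    using multi_index_at_eq[OF j(1) assms(1) j(2)] multi_index_at_eq[OF i(1) assms(2) i(2)] .
  ultimately show "unfolding_mat J I A $$ (r, c)
      = reshape (J @ I) B (prod_list J) (prod_list I) $$ (r, c)"
    using r c eq[OF j(1) i(1)]
    by (simp add: unfolding_mat_def reshape_def prod_nth_eq_prod_list)
qed (simp_all add: unfolding_mat_def reshape_def prod_nth_eq_prod_list)

theorem proposition4p8:
  fixes N :: nat and J I :: "nat list" and A A_tilde :: "nat list \<Rightarrow> real"
  assumes "N \<ge> 1" and "length J = N" and "length I = N"
    and "A \<in> tensors (splice J I)"
    and "A_tilde \<in> tensors (J @ I)"
    and "\<And>j i. j \<in> multi_indices J \<Longrightarrow> i \<in> multi_indices I \<Longrightarrow> A_tilde (j @ i) = A (splice j i)"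
  shows "rank_U J I A = optimal_TT_rank (J @ I) A_tilde N"
proof -
  have "(\<Prod>k<N. (J @ I) ! k) = (\<Prod>k<length J. J ! k)"
    using assms(2) by (intro prod.cong) (auto simp: nth_append)
  then have rows: "(\<Prod>k<N. (J @ I) ! k) = prod_list J"
    by (simp only: prod_nth_eq_prod_list)
  \<comment> \<open>From position \<open>N\<close> on, \<open>J @ I\<close> lists the sizes in
    \<open>I\<close>; the bijection is the shift by \<open>N\<close>.\<close>
  have "(\<Prod>k=N..<length (J @ I). (J @ I) ! k) = (\<Prod>k<length I. I ! k)"
    using assms(2)
    by (intro prod.reindex_bij_witness[of _ "\<lambda>k. k + N" "\<lambda>k. k - N"]) (auto simp: nth_append)
  then have cols: "(\<Prod>k=N..<length (J @ I). (J @ I) ! k) = prod_list I"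
    by (simp only: prod_nth_eq_prod_list)
  \<comment> \<open>Here \<open>N \<ge> 1\<close> enters: \<open>ivec\<close> reads entry 0, which
    is unspecified for an empty list.\<close>
  have "J \<noteq> []" "I \<noteq> []"
    using assms(1-3) by auto
  then show ?thesis
    unfolding rank_U_def optimal_TT_rank_def rows cols
    using unfolding_mat_eq_reshape[of J I A_tilde A] assms(6) by simp
qed

end
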